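(* Let $T$ be a strong monad and $R$ a $T$-algebra. The functional $T\text{-}\mathsf{EPS}$ (the explicitly controlled iterated product of $T$-selection functions) is definable, by a term of System T, from $\mathsf{EPQ}$ (the explicitly controlled iterated product of quantifiers, at suitable types).
   Context: Work in Heyting arithmetic in all finite types with full extensionality (System T with products, finite sequences $X^*$ and finite power sets), extended with bar induction: for a universal formula $P(s)$, $s \colon X^*$, if ($\omega(s^+) < |s|$ implies $P(s)$) and ($\omega(s^+) \geq |s|$ and $\forall x P(s*x)$ implies $P(s)$) for all $s$, then $P(\langle\,\rangle)$. Every type has a default element $\mathbf{0}$; $s^+ \colon X^{\mathbb{N}}$ extends finite $s$ with $\mathbf{0}$'s; $s*x$ appends, $x*r$ prepends; $|s|$ is length. A strong monad $T$ has $\eta_X \colon X \to TX$ and $(\cdot)^\dagger \colon (X \to TY) \to (TX \to TY)$ with $(\eta_X)^\dagger = \mathrm{id}$, $g^\dagger \circ \eta = g$, $(g^\dagger \circ f)^\dagger = g^\dagger \circ f^\dagger$; a $T$-algebra $R$ has $(\cdot)^* \colon (Y \to R) \to (TY \to R)$ with $g^* \circ \eta = g$, $(g^* \circ f)^* = g^* \circ f^\dagger$. The product of $T$ is $a \otimes^T f = (\lambda x . (\lambda r . \eta(x,r))^\dagger(f x))^\dagger(a)$, with pairs $(x,r)$ identified with sequences $x*r$. For $q$ defined on sequences, $q_x(r) = q(x*r)$. Given $\omega \colon X^{\mathbb{N}} \to \mathbb{N}$ and $\varepsilon \colon X^* \to ((X \to R) \to TX)$, $T\text{-}\mathsf{EPS}^\omega_s(\varepsilon)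 \colon (X^* \to R) \to T(X^* )$ is the functional satisfying: $T\text{-}\mathsf{EPS}^\omega_s(\varepsilon)(q) = \eta^T(\langle\,\rangle)$ if $\omega(s^+) < |s|$, and otherwise $= a \otimes^T f$ where $f(x) = T\text{-}\mathsf{EPS}^\omega_{s*x}(\varepsilon)(q_x)$ and $a = \varepsilon_s(\lambda x . (q_x)^*(f x))$. For an arbitrary type $R'$ and $\phi \colon X^* \to ((X \to R') \to R')$, $\mathsf{EPQ}^\omega_s(\phi) \colon (X^* \to R') \to R'$ is the functional satisfying: $\mathsf{EPQ}^\omega_s(\phi)(q) = q(\langle\,\rangle)$ if $\omega(s^+) < |s|$, and otherwise $= \phi_s(\lambda x . \mathsf{EPQ}^\omega_{s*x}(\phi)(q_x))$. *)

theory Defs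
  imports Main
begin

section \<open>System T with products, finite sequences and finite power sets\<close>

datatype ty =
    Nat
  | Fn ty ty  (infixr "\<rightarrow>" 65)
  | Prd ty ty
  | Seq ty
  | Fin ty

datatype cst =
    Zero | Succ | RecN ty
  | Pair ty ty | Fst ty ty | Snd ty ty
  | NilS ty | ConsS ty | RecS ty ty
  | Empty ty | Sing ty | Cup ty | BigCup ty ty
  | EPQ ty ty

text \<open>
  The constants \<open>EPQ X R\<close> are not part of System T. They are constrained only by the
  additional axioms \<open>EPQ_axioms\<close> below.
  \<open>BigCup X Y f a\<close> is the union of all \<open>f x\<close> with \<open>x \<in> a\<close>.
\<close>

fun EPQ_ty :: "ty \<Rightarrow> ty \<Rightarrow> ty" where
  "EPQ_ty X R =
     ((Nat \<rightarrow> X) \<rightarrow> Nat) \<rightarrow> Seq X \<rightarrow> (Seq X \<rightarrow> (X \<rightarrow> R) \<rightarrow> R) \<rightarrow> (Seq X \<rightarrow> R) \<rightarrow> R"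

primrec cst_ty :: "cst \<Rightarrow> ty" where
  "cst_ty Zero = Nat"
| "cst_ty Succ = Nat \<rightarrow> Nat"
| "cst_ty (RecN A) = A \<rightarrow> (Nat \<rightarrow> A \<rightarrow> A) \<rightarrow> Nat \<rightarrow> A"
| "cst_ty (Pair X Y) = X \<rightarrow> Y \<rightarrow> Prd X Y"
| "cst_ty (Fst X Y) = Prd X Y \<rightarrow> X"
| "cst_ty (Snd X Y) = Prd X Y \<rightarrow> Y"
| "cst_ty (NilS X) = Seq X"
| "cst_ty (ConsS X) = X \<rightarrow> Seq X \<rightarrow> Seq X"
| "cst_ty (RecS X A) = A \<rightarrow> (X \<rightarrow> Seq X \<rightarrow> A \<rightarrow> A) \<rightarrow> Seq X \<rightarrow> A"
| "cst_ty (Empty X) = Fin X"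
| "cst_ty (Sing X) = X \<rightarrow> Fin X"
| "cst_ty (Cup X) = Fin X \<rightarrow> Fin X \<rightarrow> Fin X"
| "cst_ty (BigCup X Y) = (X \<rightarrow> Fin Y) \<rightarrow> Fin X \<rightarrow> Fin Y"
| "cst_ty (EPQ X R) = EPQ_ty X R"

text \<open>Terms and formulas use de Bruijn indices; \<open>Lam\<close>, \<open>All\<close> and \<open>Ex\<close> bind index 0.\<close>

datatype tm =
    Var nat
  | Cst cst
  | App tm tm  (infixl "\<cdot>" 100)
  | Lam ty tm

inductive has_type :: "ty list \<Rightarrow> tm \<Rightarrow> ty \<Rightarrow> bool" where
  "i < length \<Gamma> \<Longrightarrow> has_type \<Gamma> (Var i) (\<Gamma> ! i)"
| "has_type \<Gamma> (Cst c) (cst_ty c)"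
| "\<lbrakk>has_type \<Gamma> t (X \<rightarrow> Y); has_type \<Gamma> u X\<rbrakk> \<Longrightarrow> has_type \<Gamma> (t \<cdot> u) Y"
| "has_type (X # \<Gamma>) t Y \<Longrightarrow> has_type \<Gamma> (Lam X t) (X \<rightarrow> Y)"

primrec lift :: "nat \<Rightarrow> tm \<Rightarrow> tm" where
  "lift k (Var i) = Var (if i < k then i else Suc i)"
| "lift k (Cst c) = Cst c"
| "lift k (t \<cdot> u) = lift k t \<cdot> lift k u"
| "lift k (Lam X t) = Lam X (lift (Suc k) t)"

text \<open>\<open>subst k v t\<close> replaces index \<open>k\<close> by \<open>v\<close> in \<open>t\<close> and lowers the indices above \<open>k\<close>.\<close>

primrec subst :: "nat \<Rightarrow> tm \<Rightarrow> tm \<Rightarrow> tm" where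
  "subst k v (Var i) = (if i < k then Var i else if i = k then v else Var (i - 1))"
| "subst k v (Cst c) = Cst c"
| "subst k v (t \<cdot> u) = subst k v t \<cdot> subst k v u"
| "subst k v (Lam X t) = Lam X (subst (Suc k) (lift 0 v) t)"

primrec systemT :: "tm \<Rightarrow> bool" where
  "systemT (Var i) = True"
| "systemT (Cst c) = (\<forall>X R. c \<noteq> EPQ X R)"
| "systemT (t \<cdot> u) = (systemT t \<and> systemT u)"
| "systemT (Lam X t) = systemT t"

primrec dflt :: "ty \<Rightarrow> tm" where
  "dflt Nat = Cst Zero"
| "dflt (X \<rightarrow> Y) = Lam X (dflt Y)"
| "dflt (Prd X Y) = Cst (Pair X Y) \<cdot> dflt X \<cdot> dflt Y"
| "dflt (Seq X) = Cst (NilS X)"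
| "dflt (Fin X) = Cst (Empty X)"

text \<open>\<open>len s = |s|\<close>, \<open>snoc s x = s*x\<close>, \<open>ConsS x r = x*r\<close>, \<open>shift q x = q_x\<close>, and \<open>pad s\<close> is
  the extension of \<open>s\<close> by default elements to an infinite sequence.\<close>

definition len :: "ty \<Rightarrow> tm" where
  "len X = Cst (RecS X Nat) \<cdot> Cst Zero \<cdot> Lam X (Lam (Seq X) (Lam Nat (Cst Succ \<cdot> Var 0)))"

definition snoc :: "ty \<Rightarrow> tm" where
  "snoc X = Lam (Seq X) (Lam X
     (Cst (RecS X (Seq X)) \<cdot> (Cst (ConsS X) \<cdot> Var 0 \<cdot> Cst (NilS X))
        \<cdot> Lam X (Lam (Seq X) (Lam (Seq X) (Cst (ConsS X) \<cdot> Var 2 \<cdot> Var 0)))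
        \<cdot> Var 1))"

definition pad :: "ty \<Rightarrow> tm" where
  "pad X = Cst (RecS X (Nat \<rightarrow> X)) \<cdot> dflt (Nat \<rightarrow> X)
     \<cdot> Lam X (Lam (Seq X) (Lam (Nat \<rightarrow> X) (Lam Nat
         (Cst (RecN X) \<cdot> Var 3 \<cdot> Lam Nat (Lam X (Var 3 \<cdot> Var 1)) \<cdot> Var 0))))"

definition shift :: "ty \<Rightarrow> ty \<Rightarrow> tm" where
  "shift X R = Lam (Seq X \<rightarrow> R) (Lam X (Lam (Seq X) (Var 2 \<cdot> (Cst (ConsS X) \<cdot> Var 1 \<cdot> Var 0))))"

text \<open>Truncated subtraction.\<close>

definition monus :: tm where
  "monus = Lam Nat (Lam Nat
     (Cst (RecN Nat) \<cdot> Var 1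
        \<cdot> Lam Nat (Lam Nat (Cst (RecN Nat) \<cdot> Cst Zero \<cdot> Lam Nat (Lam Nat (Var 1)) \<cdot> Var 0))
        \<cdot> Var 0))"

definition ident :: "ty \<Rightarrow> tm" where
  "ident X = Lam X (Var 0)"

definition compose :: "ty \<Rightarrow> ty \<Rightarrow> ty \<Rightarrow> tm" where
  "compose X Y Z = Lam (Y \<rightarrow> Z) (Lam (X \<rightarrow> Y) (Lam X (Var 2 \<cdot> (Var 1 \<cdot> Var 0))))"

section \<open>Extensional Heyting arithmetic in all finite types with bar induction\<close>

datatype fm =
    Eq ty tm tm
  | Mem ty tm tm
  | Bot
  | And fm fm
  | Or fm fm
  | Imp fm fm
  | All ty fm
  | Ex ty fm

abbreviation Iff :: "fm \<Rightarrow> fm \<Rightarrow> fm" where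
  "Iff A B \<equiv> And (Imp A B) (Imp B A)"

primrec wff :: "ty list \<Rightarrow> fm \<Rightarrow> bool" where
  "wff \<Gamma> (Eq X t u) = (has_type \<Gamma> t X \<and> has_type \<Gamma> u X)"
| "wff \<Gamma> (Mem X t u) = (has_type \<Gamma> t X \<and> has_type \<Gamma> u (Fin X))"
| "wff \<Gamma> Bot = True"
| "wff \<Gamma> (And A B) = (wff \<Gamma> A \<and> wff \<Gamma> B)"
| "wff \<Gamma> (Or A B) = (wff \<Gamma> A \<and> wff \<Gamma> B)"
| "wff \<Gamma> (Imp A B) = (wff \<Gamma> A \<and> wff \<Gamma> B)"
| "wff \<Gamma> (All X A) = wff (X # \<Gamma>) A"
| "wff \<Gamma> (Ex X A) = wff (X # \<Gamma>) A"

primrec liftf :: "nat \<Rightarrow> fm \<Rightarrow> fm" where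
  "liftf k (Eq X t u) = Eq X (lift k t) (lift k u)"
| "liftf k (Mem X t u) = Mem X (lift k t) (lift k u)"
| "liftf k Bot = Bot"
| "liftf k (And A B) = And (liftf k A) (liftf k B)"
| "liftf k (Or A B) = Or (liftf k A) (liftf k B)"
| "liftf k (Imp A B) = Imp (liftf k A) (liftf k B)"
| "liftf k (All X A) = All X (liftf (Suc k) A)"
| "liftf k (Ex X A) = Ex X (liftf (Suc k) A)"

primrec substf :: "nat \<Rightarrow> tm \<Rightarrow> fm \<Rightarrow> fm" where
  "substf k v (Eq X t u) = Eq X (subst k v t) (subst k v u)"
| "substf k v (Mem X t u) = Mem X (subst k v t) (subst k v u)"
| "substf k v Bot = Bot"
| "substf k v (And A B) = And (substf k v A) (substf k v B)"
| "substf k v (Or A B) = Or (substf k v A) (substf k v B)"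
| "substf k v (Imp A B) = Imp (substf k v A) (substf k v B)"
| "substf k v (All X A) = All X (substf (Suc k) (lift 0 v) A)"
| "substf k v (Ex X A) = Ex X (substf (Suc k) (lift 0 v) A)"

primrec quantifier_free :: "fm \<Rightarrow> bool" where
  "quantifier_free (Eq X t u) = True"
| "quantifier_free (Mem X t u) = True"
| "quantifier_free Bot = True"
| "quantifier_free (And A B) = (quantifier_free A \<and> quantifier_free B)"
| "quantifier_free (Or A B) = (quantifier_free A \<and> quantifier_free B)"
| "quantifier_free (Imp A B) = (quantifier_free A \<and> quantifier_free B)"
| "quantifier_free (All X A) = False"
| "quantifier_free (Ex X A) = False"

inductive universal :: "fm \<Rightarrow> bool" where
  "quantifier_free A \<Longrightarrow> universal A"
| "universal A \<Longrightarrow> universal (All X A)"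

definition Less :: "tm \<Rightarrow> tm \<Rightarrow> fm" where
  "Less m n = Eq Nat (monus \<cdot> (Cst Succ \<cdot> m) \<cdot> n) (Cst Zero)"

definition GreaterEq :: "tm \<Rightarrow> tm \<Rightarrow> fm" where
  "GreaterEq m n = Eq Nat (monus \<cdot> n \<cdot> m) (Cst Zero)"

text \<open>\<open>Stop X \<omega> s\<close> says \<open>\<omega>(s\<^sup>+) < |s|\<close>, and \<open>Continue X \<omega> s\<close> says \<open>\<omega>(s\<^sup>+) \<ge> |s|\<close>.\<close>

definition Stop :: "ty \<Rightarrow> tm \<Rightarrow> tm \<Rightarrow> fm" where
  "Stop X \<omega> s = Less (\<omega> \<cdot> (pad X \<cdot> s)) (len X \<cdot> s)"

definition Continue :: "ty \<Rightarrow> tm \<Rightarrow> tm \<Rightarrow> fm" where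
  "Continue X \<omega> s = GreaterEq (\<omega> \<cdot> (pad X \<cdot> s)) (len X \<cdot> s)"

text \<open>
  The non-logical axioms, as formulas in the variable context \<open>\<Gamma>\<close>. If \<open>A\<close> is a formula whose
  index 0 is the induction variable, then \<open>substf 0 t (liftf 1 A)\<close> is \<open>A(t)\<close> under one
  quantifier, and \<open>substf 0 t (liftf 1 (liftf 1 A))\<close> is \<open>A(t)\<close> under two.
\<close>

inductive axiom :: "ty list \<Rightarrow> fm \<Rightarrow> bool" for \<Gamma> where
  beta: "\<lbrakk>has_type (X # \<Gamma>) t Y; has_type \<Gamma> u X\<rbrakk>
    \<Longrightarrow> axiom \<Gamma> (Eq Y (Lam X t \<cdot> u) (subst 0 u t))"
| extensionality: "\<lbrakk>has_type \<Gamma> t (X \<rightarrow> Y); has_type \<Gamma> u (X \<rightarrow> Y)\<rbrakk>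
    \<Longrightarrow> axiom \<Gamma> (Imp (All X (Eq Y (lift 0 t \<cdot> Var 0) (lift 0 u \<cdot> Var 0))) (Eq (X \<rightarrow> Y) t u))"

| Succ_neq_Zero: "has_type \<Gamma> n Nat
    \<Longrightarrow> axiom \<Gamma> (Imp (Eq Nat (Cst Succ \<cdot> n) (Cst Zero)) Bot)"
| Succ_inject: "\<lbrakk>has_type \<Gamma> m Nat; has_type \<Gamma> n Nat\<rbrakk>
    \<Longrightarrow> axiom \<Gamma> (Imp (Eq Nat (Cst Succ \<cdot> m) (Cst Succ \<cdot> n)) (Eq Nat m n))"
| RecN_Zero: "\<lbrakk>has_type \<Gamma> a Y; has_type \<Gamma> h (Nat \<rightarrow> Y \<rightarrow> Y)\<rbrakk>
    \<Longrightarrow> axiom \<Gamma> (Eq Y (Cst (RecN Y) \<cdot> a \<cdot> h \<cdot> Cst Zero) a)"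
| RecN_Succ: "\<lbrakk>has_type \<Gamma> a Y; has_type \<Gamma> h (Nat \<rightarrow> Y \<rightarrow> Y); has_type \<Gamma> n Nat\<rbrakk>
    \<Longrightarrow> axiom \<Gamma> (Eq Y (Cst (RecN Y) \<cdot> a \<cdot> h \<cdot> (Cst Succ \<cdot> n))
                       (h \<cdot> n \<cdot> (Cst (RecN Y) \<cdot> a \<cdot> h \<cdot> n)))"
| Nat_induction: "wff (Nat # \<Gamma>) A
    \<Longrightarrow> axiom \<Gamma> (Imp (substf 0 (Cst Zero) A)
                 (Imp (All Nat (Imp A (substf 0 (Cst Succ \<cdot> Var 0) (liftf 1 A))))
                      (All Nat A)))"

| Fst_Pair: "\<lbrakk>has_type \<Gamma> a X; has_type \<Gamma> b Y\<rbrakk>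
    \<Longrightarrow> axiom \<Gamma> (Eq X (Cst (Fst X Y) \<cdot> (Cst (Pair X Y) \<cdot> a \<cdot> b)) a)"
| Snd_Pair: "\<lbrakk>has_type \<Gamma> a X; has_type \<Gamma> b Y\<rbrakk>
    \<Longrightarrow> axiom \<Gamma> (Eq Y (Cst (Snd X Y) \<cdot> (Cst (Pair X Y) \<cdot> a \<cdot> b)) b)"
| surjective_pairing: "has_type \<Gamma> p (Prd X Y)
    \<Longrightarrow> axiom \<Gamma> (Eq (Prd X Y) (Cst (Pair X Y) \<cdot> (Cst (Fst X Y) \<cdot> p) \<cdot> (Cst (Snd X Y) \<cdot> p)) p)"

| RecS_NilS: "\<lbrakk>has_type \<Gamma> a Y; has_type \<Gamma> h (X \<rightarrow> Seq X \<rightarrow> Y \<rightarrow> Y)\<rbrakk>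
    \<Longrightarrow> axiom \<Gamma> (Eq Y (Cst (RecS X Y) \<cdot> a \<cdot> h \<cdot> Cst (NilS X)) a)"
| RecS_ConsS: "\<lbrakk>has_type \<Gamma> a Y; has_type \<Gamma> h (X \<rightarrow> Seq X \<rightarrow> Y \<rightarrow> Y);
      has_type \<Gamma> x X; has_type \<Gamma> s (Seq X)\<rbrakk>
    \<Longrightarrow> axiom \<Gamma> (Eq Y (Cst (RecS X Y) \<cdot> a \<cdot> h \<cdot> (Cst (ConsS X) \<cdot> x \<cdot> s))
                       (h \<cdot> x \<cdot> s \<cdot> (Cst (RecS X Y) \<cdot> a \<cdot> h \<cdot> s)))"
| Seq_induction: "wff (Seq X # \<Gamma>) A
    \<Longrightarrow> axiom \<Gamma> (Imp (substf 0 (Cst (NilS X)) A)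
                 (Imp (All X (All (Seq X) (Imp (liftf 1 A)
                        (substf 0 (Cst (ConsS X) \<cdot> Var 1 \<cdot> Var 0) (liftf 1 (liftf 1 A))))))
                      (All (Seq X) A)))"

| Mem_Empty: "has_type \<Gamma> x X
    \<Longrightarrow> axiom \<Gamma> (Imp (Mem X x (Cst (Empty X))) Bot)"
| Mem_Sing: "\<lbrakk>has_type \<Gamma> x X; has_type \<Gamma> y X\<rbrakk>
    \<Longrightarrow> axiom \<Gamma> (Iff (Mem X x (Cst (Sing X) \<cdot> y)) (Eq X x y))"
| Mem_Cup: "\<lbrakk>has_type \<Gamma> x X; has_type \<Gamma> a (Fin X); has_type \<Gamma> b (Fin X)\<rbrakk>
    \<Longrightarrow> axiom \<Gamma> (Iff (Mem X x (Cst (Cup X) \<cdot> a \<cdot> b)) (Or (Mem X x a) (Mem X x b)))"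
| Mem_BigCup: "\<lbrakk>has_type \<Gamma> y Y; has_type \<Gamma> f (X \<rightarrow> Fin Y); has_type \<Gamma> a (Fin X)\<rbrakk>
    \<Longrightarrow> axiom \<Gamma> (Iff (Mem Y y (Cst (BigCup X Y) \<cdot> f \<cdot> a))
                  (Ex X (And (Mem X (Var 0) (lift 0 a)) (Mem Y (lift 0 y) (lift 0 f \<cdot> Var 0)))))"
| Fin_extensionality: "\<lbrakk>has_type \<Gamma> a (Fin X); has_type \<Gamma> b (Fin X)\<rbrakk>
    \<Longrightarrow> axiom \<Gamma> (Imp (All X (Iff (Mem X (Var 0) (lift 0 a)) (Mem X (Var 0) (lift 0 b))))
                      (Eq (Fin X) a b))"
| Fin_induction: "wff (Fin X # \<Gamma>) A
    \<Longrightarrow> axiom \<Gamma> (Imp (substf 0 (Cst (Empty X)) A)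
                 (Imp (All X (All (Fin X) (Imp (liftf 1 A)
                        (substf 0 (Cst (Cup X) \<cdot> (Cst (Sing X) \<cdot> Var 1) \<cdot> Var 0)
                           (liftf 1 (liftf 1 A))))))
                      (All (Fin X) A)))"

| bar_induction: "\<lbrakk>wff (Seq X # \<Gamma>) P; universal P; has_type \<Gamma> \<omega> ((Nat \<rightarrow> X) \<rightarrow> Nat)\<rbrakk>
    \<Longrightarrow> axiom \<Gamma> (Imp (All (Seq X)
                   (And (Imp (Stop X (lift 0 \<omega>) (Var 0)) P)
                        (Imp (And (Continue X (lift 0 \<omega>) (Var 0))
                                  (All X (substf 0 (snoc X \<cdot> Var 1 \<cdot> Var 0) (liftf 1 (liftf 1 P)))))
                             P)))
                 (substf 0 (Cst (NilS X)) P))"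

text \<open>
  Intuitionistic natural deduction: \<open>prov Ax \<Gamma> H A\<close> means that the formula \<open>A\<close> in the variable
  context \<open>\<Gamma>\<close> follows from the hypotheses \<open>H\<close>, the axioms above and the sentences in \<open>Ax\<close>.
\<close>

inductive prov :: "fm set \<Rightarrow> ty list \<Rightarrow> fm set \<Rightarrow> fm \<Rightarrow> bool" for Ax where
  hyp: "A \<in> H \<Longrightarrow> wff \<Gamma> A \<Longrightarrow> prov Ax \<Gamma> H A"
| ax: "axiom \<Gamma> A \<Longrightarrow> prov Ax \<Gamma> H A"
| extra: "A \<in> Ax \<Longrightarrow> wff [] A \<Longrightarrow> prov Ax \<Gamma> H A"
| BotE: "\<lbrakk>prov Ax \<Gamma> H Bot; wff \<Gamma> A\<rbrakk> \<Longrightarrow> prov Ax \<Gamma> H A"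
| AndI: "\<lbrakk>prov Ax \<Gamma> H A; prov Ax \<Gamma> H B\<rbrakk> \<Longrightarrow> prov Ax \<Gamma> H (And A B)"
| AndE1: "prov Ax \<Gamma> H (And A B) \<Longrightarrow> prov Ax \<Gamma> H A"
| AndE2: "prov Ax \<Gamma> H (And A B) \<Longrightarrow> prov Ax \<Gamma> H B"
| OrI1: "\<lbrakk>prov Ax \<Gamma> H A; wff \<Gamma> B\<rbrakk> \<Longrightarrow> prov Ax \<Gamma> H (Or A B)"
| OrI2: "\<lbrakk>prov Ax \<Gamma> H B; wff \<Gamma> A\<rbrakk> \<Longrightarrow> prov Ax \<Gamma> H (Or A B)"
| OrE: "\<lbrakk>prov Ax \<Gamma> H (Or A B); prov Ax \<Gamma> (insert A H) C; prov Ax \<Gamma> (insert B H) C\<rbrakk>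
    \<Longrightarrow> prov Ax \<Gamma> H C"
| ImpI: "\<lbrakk>prov Ax \<Gamma> (insert A H) B; wff \<Gamma> A\<rbrakk> \<Longrightarrow> prov Ax \<Gamma> H (Imp A B)"
| ImpE: "\<lbrakk>prov Ax \<Gamma> H (Imp A B); prov Ax \<Gamma> H A\<rbrakk> \<Longrightarrow> prov Ax \<Gamma> H B"
| AllI: "prov Ax (X # \<Gamma>) (liftf 0 ` H) A \<Longrightarrow> prov Ax \<Gamma> H (All X A)"
| AllE: "\<lbrakk>prov Ax \<Gamma> H (All X A); has_type \<Gamma> t X\<rbrakk> \<Longrightarrow> prov Ax \<Gamma> H (substf 0 t A)"
| ExI: "\<lbrakk>prov Ax \<Gamma> H (substf 0 t A); has_type \<Gamma> t X; wff (X # \<Gamma>) A\<rbrakk> \<Longrightarrow> prov Ax \<Gamma> H (Ex X A)"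
| ExE: "\<lbrakk>prov Ax \<Gamma> H (Ex X A); prov Ax (X # \<Gamma>) (insert A (liftf 0 ` H)) (liftf 0 C)\<rbrakk>
    \<Longrightarrow> prov Ax \<Gamma> H C"
| EqI: "has_type \<Gamma> t X \<Longrightarrow> prov Ax \<Gamma> H (Eq X t t)"
| EqE: "\<lbrakk>prov Ax \<Gamma> H (Eq X t u); prov Ax \<Gamma> H (substf 0 t A); wff (X # \<Gamma>) A\<rbrakk>
    \<Longrightarrow> prov Ax \<Gamma> H (substf 0 u A)"

abbreviation provable :: "fm set \<Rightarrow> fm \<Rightarrow> bool" where
  "provable Ax A \<equiv> prov Ax [] {} A"

section \<open>Strong monads and their algebras\<close>

abbreviation systemT_closed :: "tm \<Rightarrow> ty \<Rightarrow> bool" where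
  "systemT_closed t X \<equiv> systemT t \<and> has_type [] t X"

definition strong_monad :: "(ty \<Rightarrow> ty) \<Rightarrow> (ty \<Rightarrow> tm) \<Rightarrow> (ty \<Rightarrow> ty \<Rightarrow> tm) \<Rightarrow> bool" where
  "strong_monad T eta ext \<longleftrightarrow>
     (\<forall>X. systemT_closed (eta X) (X \<rightarrow> T X)) \<and>
     (\<forall>X Y. systemT_closed (ext X Y) ((X \<rightarrow> T Y) \<rightarrow> T X \<rightarrow> T Y)) \<and>
     (\<forall>X. provable {} (Eq (T X \<rightarrow> T X) (ext X X \<cdot> eta X) (ident (T X)))) \<and>
     (\<forall>X Y. provable {}
        (All (X \<rightarrow> T Y)
          (Eq (X \<rightarrow> T Y) (compose X (T X) (T Y) \<cdot> (ext X Y \<cdot> Var 0) \<cdot> eta X) (Var 0)))) \<and>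
     (\<forall>X Y Z. provable {}
        (All (Y \<rightarrow> T Z) (All (X \<rightarrow> T Y)
          (Eq (T X \<rightarrow> T Z)
             (ext X Z \<cdot> (compose X (T Y) (T Z) \<cdot> (ext Y Z \<cdot> Var 1) \<cdot> Var 0))
             (compose (T X) (T Y) (T Z) \<cdot> (ext Y Z \<cdot> Var 1) \<cdot> (ext X Y \<cdot> Var 0))))))"

definition monad_algebra ::
    "(ty \<Rightarrow> ty) \<Rightarrow> (ty \<Rightarrow> tm) \<Rightarrow> (ty \<Rightarrow> ty \<Rightarrow> tm) \<Rightarrow> ty \<Rightarrow> (ty \<Rightarrow> tm) \<Rightarrow> bool" where
  "monad_algebra T eta ext R star \<longleftrightarrow>
     (\<forall>Y. systemT_closed (star Y) ((Y \<rightarrow> R) \<rightarrow> T Y \<rightarrow> R)) \<and>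
     (\<forall>Y. provable {}
        (All (Y \<rightarrow> R)
          (Eq (Y \<rightarrow> R) (compose Y (T Y) R \<cdot> (star Y \<cdot> Var 0) \<cdot> eta Y) (Var 0)))) \<and>
     (\<forall>X Y. provable {}
        (All (Y \<rightarrow> R) (All (X \<rightarrow> T Y)
          (Eq (T X \<rightarrow> R)
             (star X \<cdot> (compose X (T Y) R \<cdot> (star Y \<cdot> Var 1) \<cdot> Var 0))
             (compose (T X) (T Y) R \<cdot> (star Y \<cdot> Var 1) \<cdot> (ext X Y \<cdot> Var 0))))))"

text \<open>The product \<open>\<lambda>a f. a \<otimes> f\<close> on \<open>T X\<close> and \<open>X \<rightarrow> T (Seq X)\<close>, where the pair of \<open>x\<close> and \<open>r\<close>
  is the sequence \<open>x*r\<close>.\<close>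

definition tensor :: "(ty \<Rightarrow> ty) \<Rightarrow> (ty \<Rightarrow> tm) \<Rightarrow> (ty \<Rightarrow> ty \<Rightarrow> tm) \<Rightarrow> ty \<Rightarrow> tm" where
  "tensor T eta ext X =
     Lam (T X) (Lam (X \<rightarrow> T (Seq X))
       (ext X (Seq X)
          \<cdot> Lam X (ext (Seq X) (Seq X)
                     \<cdot> Lam (Seq X) (eta (Seq X) \<cdot> (Cst (ConsS X) \<cdot> Var 1 \<cdot> Var 0))
                     \<cdot> (Var 1 \<cdot> Var 0))
          \<cdot> Var 1))"

section \<open>The defining equations of EPQ and T-EPS\<close>

text \<open>The variables \<open>\<omega>\<close>, \<open>s\<close>, \<open>\<phi>\<close> (resp. \<open>\<epsilon>\<close>), \<open>q\<close> are the indices 3, 2, 1, 0; under a further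
  \<open>Lam X\<close> they are 4, 3, 2, 1. The term \<open>e\<close> is meant to be closed.\<close>

definition EPQ_spec :: "ty \<Rightarrow> ty \<Rightarrow> tm \<Rightarrow> fm" where
  "EPQ_spec X R e =
     All ((Nat \<rightarrow> X) \<rightarrow> Nat) (All (Seq X) (All (Seq X \<rightarrow> (X \<rightarrow> R) \<rightarrow> R) (All (Seq X \<rightarrow> R)
       (And
         (Imp (Stop X (Var 3) (Var 2))
           (Eq R (e \<cdot> Var 3 \<cdot> Var 2 \<cdot> Var 1 \<cdot> Var 0) (Var 0 \<cdot> Cst (NilS X))))
         (Imp (Continue X (Var 3) (Var 2))
           (Eq R (e \<cdot> Var 3 \<cdot> Var 2 \<cdot> Var 1 \<cdot> Var 0)
             (Var 1 \<cdot> Var 2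
                \<cdot> Lam X (e \<cdot> Var 4 \<cdot> (snoc X \<cdot> Var 3 \<cdot> Var 0) \<cdot> Var 2 \<cdot> (shift X R \<cdot> Var 1 \<cdot> Var 0)))))))))"

definition EPQ_axioms :: "fm set" where
  "EPQ_axioms = {EPQ_spec X R (Cst (EPQ X R)) | X R. True}"

definition EPS_ty :: "(ty \<Rightarrow> ty) \<Rightarrow> ty \<Rightarrow> ty \<Rightarrow> ty" where
  "EPS_ty T X R =
     ((Nat \<rightarrow> X) \<rightarrow> Nat) \<rightarrow> Seq X \<rightarrow> (Seq X \<rightarrow> (X \<rightarrow> R) \<rightarrow> T X) \<rightarrow> (Seq X \<rightarrow> R) \<rightarrow> T (Seq X)"

definition EPS_spec ::
    "(ty \<Rightarrow> ty) \<Rightarrow> (ty \<Rightarrow> tm) \<Rightarrow> (ty \<Rightarrow> ty \<Rightarrow> tm) \<Rightarrow> (ty \<Rightarrow> tm) \<Rightarrow> ty \<Rightarrow> ty \<Rightarrow> tm \<Rightarrow> fm" where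
  "EPS_spec T eta ext star X R e =
     (let f = Lam X (e \<cdot> Var 4 \<cdot> (snoc X \<cdot> Var 3 \<cdot> Var 0) \<cdot> Var 2 \<cdot> (shift X R \<cdot> Var 1 \<cdot> Var 0));
          a = Var 1 \<cdot> Var 2 \<cdot> Lam X (star (Seq X) \<cdot> (shift X R \<cdot> Var 1 \<cdot> Var 0) \<cdot> (lift 0 f \<cdot> Var 0))
      in
      All ((Nat \<rightarrow> X) \<rightarrow> Nat) (All (Seq X) (All (Seq X \<rightarrow> (X \<rightarrow> R) \<rightarrow> T X) (All (Seq X \<rightarrow> R)
        (And
          (Imp (Stop X (Var 3) (Var 2))
            (Eq (T (Seq X)) (e \<cdot> Var 3 \<cdot> Var 2 \<cdot> Var 1 \<cdot> Var 0) (eta (Seq X) \<cdot> Cst (NilS X))))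
          (Imp (Continue X (Var 3) (Var 2))
            (Eq (T (Seq X)) (e \<cdot> Var 3 \<cdot> Var 2 \<cdot> Var 1 \<cdot> Var 0)
              (tensor T eta ext X \<cdot> a \<cdot> f))))))))"

text \<open>T-EPS is definable from EPQ: some closed term of System T with the constants EPQ provably
  satisfies the defining equations of T-EPS, uniformly in all its arguments.\<close>

definition EPS_definable_from_EPQ ::
    "(ty \<Rightarrow> ty) \<Rightarrow> (ty \<Rightarrow> tm) \<Rightarrow> (ty \<Rightarrow> ty \<Rightarrow> tm) \<Rightarrow> (ty \<Rightarrow> tm) \<Rightarrow> ty \<Rightarrow> ty \<Rightarrow> bool" where
  "EPS_definable_from_EPQ T eta ext star X R \<longleftrightarrow>
     (\<exists>t. has_type [] t (EPS_ty T X R) \<and> provable EPQ_axioms (EPS_spec T eta ext star X R t))"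

end

theory Submission
  imports Defs
begin

text \<open>
  T-EPS is EPQ at the result type \<open>R' = (Seq X \<rightarrow> R) \<rightarrow> T (Seq X)\<close>, so that the outcome function
  \<open>q\<close> is threaded through the recursion as an argument of the result:
  with \<open>\<phi>\<^sub>s(p) = \<lambda>q. \<epsilon>\<^sub>s(\<lambda>x. (q\<^sub>x)\<^sup>*(p x q\<^sub>x)) \<otimes> (\<lambda>x. p x q\<^sub>x)\<close> and the constant function
  \<open>Q = \<lambda>r q. \<eta>\<langle>\<rangle>\<close>, the term \<open>EPQ\<^sub>s(\<phi>)(Q)(q)\<close> satisfies the equations of \<open>T-EPS\<^sub>s(\<epsilon>)(q)\<close>, because
  \<open>Q\<^sub>x = Q\<close> by extensionality.
\<close>

section \<open>Substitution and typing\<close>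

text \<open>Abstractions carry the type of their argument, so types are unique and computable.
  Typing goals for concrete terms thereby become simplification problems.\<close>

primrec infer :: "tm \<Rightarrow> ty list \<Rightarrow> ty option" where
  "infer (Var i) \<Gamma> = (if i < length \<Gamma> then Some (\<Gamma> ! i) else None)"
| "infer (Cst c) \<Gamma> = Some (cst_ty c)"
| "infer (t \<cdot> u) \<Gamma> = (case infer t \<Gamma> of
      Some (X \<rightarrow> Y) \<Rightarrow> if infer u \<Gamma> = Some X then Some Y else None
    | _ \<Rightarrow> None)"
| "infer (Lam X t) \<Gamma> = map_option (Fn X) (infer t (X # \<Gamma>))"

lemma has_type_iff_infer: "has_type \<Gamma> t X \<longleftrightarrow> infer t \<Gamma> = Some X"
proof
  show "has_type \<Gamma> t X \<Longrightarrow> infer t \<Gamma> = Some X"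
    by (induction rule: has_type.induct) auto
next
  show "infer t \<Gamma> = Some X \<Longrightarrow> has_type \<Gamma> t X"
  proof (induction t arbitrary: \<Gamma> X)
    case (App t u)
    then show ?case
      by (auto intro!: has_type.intros(3) split: option.splits ty.splits if_splits)
  qed (auto intro: has_type.intros split: if_splits)
qed

lemma subst_lift [simp]: "subst k v (lift k t) = t"
  by (induction t arbitrary: k v) auto

text \<open>Index \<open>k\<close> stays put, and the gap that lifting opens at \<open>Suc k\<close>
  is closed again. For \<open>k = 0\<close> this is the beta step from
  \<open>lift 0 (Lam X w) \<cdot> Var 0\<close> to \<open>w\<close>.\<close>

lemma subst_Var_lift_Suc [simp]: "subst k (Var k) (lift (Suc k) t) = t"
  by (induction t arbitrary: k) auto

lemma lift_lift: "i \<le> k \<Longrightarrow> lift i (lift k t) = lift (Suc k) (lift i t)"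
  by (induction t arbitrary: i k) auto

text \<open>By \<open>lift_lift\<close> the outer lifting may be read as opening a gap at index 1.
  This form arises when a substitution crosses one binder.\<close>

lemma subst_1_lift_lift [simp]: "subst (Suc 0) v (lift 0 (lift 0 t)) = lift 0 t"
  by (subst lift_lift) simp_all

lemma has_type_append: "has_type \<Gamma> t X \<Longrightarrow> has_type (\<Gamma> @ \<Delta>) t X"
proof (induction rule: has_type.induct)
  case (1 i \<Gamma>)
  then show ?case
    using has_type.intros(1)[of i "\<Gamma> @ \<Delta>"] by (simp add: nth_append)
qed (auto intro: has_type.intros)

lemma has_type_weaken: "has_type [] t X \<Longrightarrow> has_type \<Gamma> t X"
  using has_type_append[of "[]" t X \<Gamma>] by simp

lemma infer_closed: "has_type [] t X \<Longrightarrow> infer t \<Gamma> = Some X"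
  using has_type_weaken has_type_iff_infer by blast

lemma lift_ident: "has_type \<Gamma> t X \<Longrightarrow> length \<Gamma> \<le> k \<Longrightarrow> lift k t = t"
  by (induction arbitrary: k rule: has_type.induct) auto

lemma subst_ident: "has_type \<Gamma> t X \<Longrightarrow> length \<Gamma> \<le> k \<Longrightarrow> subst k v t = t"
  by (induction arbitrary: k v rule: has_type.induct) auto

lemma lift_closed: "has_type [] t X \<Longrightarrow> lift k t = t"
  by (rule lift_ident) auto

lemma subst_closed: "has_type [] t X \<Longrightarrow> subst k v t = t"
  by (rule subst_ident) auto

text \<open>\<open>\<Delta>\<close> collects the binders already crossed, which lets the induction
  pass through \<open>Lam\<close>.\<close>

lemma has_type_lift_insert:
  "has_type (\<Delta> @ \<Gamma>) t X \<Longrightarrow> has_type (\<Delta> @ Y # \<Gamma>) (lift (length \<Delta>) t) X"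
proof (induction "\<Delta> @ \<Gamma>" t X arbitrary: \<Delta> rule: has_type.induct)
  case (1 i)
  then show ?case
    using has_type.intros(1)[of "if i < length \<Delta> then i else Suc i" "\<Delta> @ Y # \<Gamma>"]
    by (auto simp: nth_append Suc_diff_le split: if_splits)
next
  case (4 X t Z)
  then show ?case
    by (metis append_Cons has_type.intros(4) length_Cons lift.simps(4))
qed (auto intro: has_type.intros)

lemma has_type_lift: "has_type \<Gamma> t X \<Longrightarrow> has_type (Y # \<Gamma>) (lift 0 t) X"
  using has_type_lift_insert[of "[]" \<Gamma> t X Y] by simp

text \<open>Again \<open>\<Delta>\<close> holds the binders crossed; \<open>v\<close> varies in the
  induction because each of them lifts it.\<close>

lemma has_type_subst_append:
  "has_type (\<Delta> @ Y # \<Gamma>) t X \<Longrightarrow> has_type (\<Delta> @ \<Gamma>) v Y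
    \<Longrightarrow> has_type (\<Delta> @ \<Gamma>) (subst (length \<Delta>) v t) X"
proof (induction "\<Delta> @ Y # \<Gamma>" t X arbitrary: \<Delta> v rule: has_type.induct)
  case (1 i)
  have "i < length \<Delta> \<Longrightarrow> ?case"
    using has_type.intros(1)[of i "\<Delta> @ \<Gamma>"] by (simp add: nth_append)
  moreover have "i = length \<Delta> \<Longrightarrow> ?case"
    using 1 by simp
  moreover have "i > length \<Delta> \<Longrightarrow> ?case"
    using 1 has_type.intros(1)[of "i - 1" "\<Delta> @ \<Gamma>"]
    by (cases i) (auto simp: nth_append Suc_diff_le)
  ultimately show ?case
    by linarith
next
  case (4 X t Z)
  have "has_type ((X # \<Delta>) @ \<Gamma>) (subst (length (X # \<Delta>)) (lift 0 v) t) Z"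
    using 4 has_type_lift[OF 4(3), of X] by (metis append_Cons)
  then show ?case
    by (auto intro: has_type.intros)
qed (auto intro: has_type.intros)

lemma has_type_subst:
  "has_type (Y # \<Gamma>) t X \<Longrightarrow> has_type \<Gamma> v Y \<Longrightarrow> has_type \<Gamma> (subst 0 v t) X"
  using has_type_subst_append[of "[]"] by simp

section \<open>Equational reasoning inside the theory\<close>

text \<open>Keeping the typings of both sides with the equation supplies the well-formedness side
  condition of \<open>EqE\<close> at each use.\<close>

definition eqv :: "fm set \<Rightarrow> ty list \<Rightarrow> fm set \<Rightarrow> ty \<Rightarrow> tm \<Rightarrow> tm \<Rightarrow> bool" where
  "eqv Ax \<Gamma> H X t u \<longleftrightarrow> has_type \<Gamma> t X \<and> has_type \<Gamma> u X \<and> prov Ax \<Gamma> H (Eq X t u)"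

lemma eqv_trans [trans]:
  assumes "eqv Ax \<Gamma> H X t u" "eqv Ax \<Gamma> H X u v"
  shows "eqv Ax \<Gamma> H X t v"
proof -
  \<comment> \<open>Leibniz's rule: \<open>EqE\<close> replaces \<open>u\<close> by \<open>v\<close>
    in the predicate of being equal to \<open>t\<close>. The next lemmas choose their predicates in
    the same way.\<close>
  let ?A = "Eq X (lift 0 t) (Var 0)"
  have "wff (X # \<Gamma>) ?A"
    using assms has_type.intros(1)[of 0 "X # \<Gamma>"] by (auto simp: eqv_def has_type_lift)
  then show ?thesis
    using assms EqE[of Ax \<Gamma> H X u v ?A] by (simp add: eqv_def)
qed

lemma eqv_sym:
  assumes "eqv Ax \<Gamma> H X t u"
  shows "eqv Ax \<Gamma> H X u t"
proof -
  let ?A = "Eq X (Var 0) (lift 0 t)"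
  have "wff (X # \<Gamma>) ?A"
    using assms has_type.intros(1)[of 0 "X # \<Gamma>"] by (auto simp: eqv_def has_type_lift)
  then show ?thesis
    using assms EqE[of Ax \<Gamma> H X t u ?A] by (simp add: eqv_def EqI)
qed

lemma eqv_fun:
  assumes "eqv Ax \<Gamma> H (X \<rightarrow> Y) t u" "has_type \<Gamma> v X"
  shows "eqv Ax \<Gamma> H Y (t \<cdot> v) (u \<cdot> v)"
proof -
  let ?A = "Eq Y (lift 0 (t \<cdot> v)) (Var 0 \<cdot> lift 0 v)"
  have "wff ((X \<rightarrow> Y) # \<Gamma>) ?A"
    using assms has_type.intros(1)[of 0 "(X \<rightarrow> Y) # \<Gamma>"]
    by (auto simp: eqv_def intro!: has_type_lift has_type.intros(3))
  then show ?thesis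
    using assms EqE[of Ax \<Gamma> H "X \<rightarrow> Y" t u ?A]
    by (auto simp: eqv_def intro!: has_type.intros(3) EqI)
qed

lemma eqv_arg:
  assumes "eqv Ax \<Gamma> H X t u" "has_type \<Gamma> f (X \<rightarrow> Y)"
  shows "eqv Ax \<Gamma> H Y (f \<cdot> t) (f \<cdot> u)"
proof -
  let ?A = "Eq Y (lift 0 (f \<cdot> t)) (lift 0 f \<cdot> Var 0)"
  have "wff (X # \<Gamma>) ?A"
    using assms has_type.intros(1)[of 0 "X # \<Gamma>"]
    by (auto simp: eqv_def intro!: has_type_lift has_type.intros(3))
  then show ?thesis
    using assms EqE[of Ax \<Gamma> H X t u ?A]
    by (auto simp: eqv_def intro!: has_type.intros(3) EqI)
qed

lemma eqv_App:
  assumes "eqv Ax \<Gamma> H (X \<rightarrow> Y) t t'" "eqv Ax \<Gamma> H X u u'"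
  shows "eqv Ax \<Gamma> H Y (t \<cdot> u) (t' \<cdot> u')"
  using eqv_trans[OF eqv_fun[OF assms(1)] eqv_arg[OF assms(2)]] assms
  by (auto simp: eqv_def)

lemma eqv_beta:
  assumes "has_type (X # \<Gamma>) t Y" "has_type \<Gamma> u X" "subst 0 u t = v"
  shows "eqv Ax \<Gamma> H Y (Lam X t \<cdot> u) v"
  using assms prov.ax[OF axiom.beta[OF assms(1,2)]]
  by (auto simp: eqv_def has_type_subst intro!: has_type.intros(3,4))

text \<open>The xi rule, obtained from extensionality: applied to a fresh variable, both
  abstractions beta-reduce to their bodies, which are equal by assumption.\<close>

lemma eqv_Lam:
  assumes "eqv Ax (X # \<Gamma>) (liftf 0 ` H) Y t u"
  shows "eqv Ax \<Gamma> H (X \<rightarrow> Y) (Lam X t) (Lam X u)"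
proof -
  have tu: "has_type (X # \<Gamma>) t Y" "has_type (X # \<Gamma>) u Y"
    using assms by (simp_all add: eqv_def)
  have 0: "has_type (X # \<Gamma>) (Var 0) X"
    using has_type.intros(1)[of 0 "X # \<Gamma>"] by simp
  have beta: "eqv Ax (X # \<Gamma>) (liftf 0 ` H) Y (lift 0 (Lam X w) \<cdot> Var 0) w"
    if "has_type (X # \<Gamma>) w Y" for w
    using eqv_beta[OF _ 0 subst_Var_lift_Suc] has_type_lift_insert[of "[X]" \<Gamma> w Y X] that
    by simp
  have "eqv Ax (X # \<Gamma>) (liftf 0 ` H) Y (lift 0 (Lam X t) \<cdot> Var 0) (lift 0 (Lam X u) \<cdot> Var 0)"
    by (rule eqv_trans[OF eqv_trans[OF beta[OF tu(1)] assms] eqv_sym[OF beta[OF tu(2)]]])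
  then have "prov Ax \<Gamma> H (All X (Eq Y (lift 0 (Lam X t) \<cdot> Var 0) (lift 0 (Lam X u) \<cdot> Var 0)))"
    unfolding eqv_def by (blast intro: AllI)
  moreover have "has_type \<Gamma> (Lam X t) (X \<rightarrow> Y)" "has_type \<Gamma> (Lam X u) (X \<rightarrow> Y)"
    using tu by (simp_all add: has_type.intros(4))
  ultimately show ?thesis
    unfolding eqv_def by (blast intro: ImpE[OF prov.ax[OF axiom.extensionality]])
qed

section \<open>The closed terms of the specification\<close>

lemma has_type_dflt: "has_type \<Gamma> (dflt X) X"
  by (induction X arbitrary: \<Gamma>) (simp_all add: has_type_iff_infer)

lemma closed_types:
  "has_type [] (len X) (Seq X \<rightarrow> Nat)"
  "has_type [] (snoc X) (Seq X \<rightarrow> X \<rightarrow> Seq X)"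
  "has_type [] (pad X) (Seq X \<rightarrow> Nat \<rightarrow> X)"
  "has_type [] (shift X R) ((Seq X \<rightarrow> R) \<rightarrow> X \<rightarrow> Seq X \<rightarrow> R)"
  "has_type [] monus (Nat \<rightarrow> Nat \<rightarrow> Nat)"
  using has_type_dflt
  by (auto simp: has_type_iff_infer len_def snoc_def pad_def shift_def monus_def)

text \<open>A typing in the empty context gives a computed type in every context and invariance
  under \<open>lift\<close> and \<open>subst\<close>, so these terms behave like constants.\<close>

lemmas closed_simps = closed_types[THEN infer_closed] closed_types[THEN lift_closed]
  closed_types[THEN subst_closed]

lemma substf_Stop [simp]: "substf k v (Stop X w s) = Stop X (subst k v w) (subst k v s)"
  by (simp add: Stop_def Less_def closed_simps)

lemma substf_Continue [simp]:
  "substf k v (Continue X w s) = Continue X (subst k v w) (subst k v s)"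
  by (simp add: Continue_def GreaterEq_def closed_simps)

lemma wff_Stop:
  "has_type \<Gamma> w ((Nat \<rightarrow> X) \<rightarrow> Nat) \<Longrightarrow> has_type \<Gamma> s (Seq X) \<Longrightarrow> wff \<Gamma> (Stop X w s)"
  by (simp add: Stop_def Less_def closed_simps has_type_iff_infer)

lemma wff_Continue:
  "has_type \<Gamma> w ((Nat \<rightarrow> X) \<rightarrow> Nat) \<Longrightarrow> has_type \<Gamma> s (Seq X) \<Longrightarrow> wff \<Gamma> (Continue X w s)"
  by (simp add: Continue_def GreaterEq_def closed_simps has_type_iff_infer)

lemma wff_EPQ_spec: "wff [] (EPQ_spec X R (Cst (EPQ X R)))"
  by (simp add: EPQ_spec_def wff_Stop wff_Continue has_type_iff_infer closed_simps)

lemma prov_EPQ_spec: "prov EPQ_axioms \<Gamma> H (EPQ_spec X R (Cst (EPQ X R)))"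
  by (rule extra) (auto simp: EPQ_axioms_def wff_EPQ_spec)

section \<open>Defining T-EPS\<close>

locale typed_algebra =
  fixes T :: "ty \<Rightarrow> ty" and eta :: "ty \<Rightarrow> tm" and ext :: "ty \<Rightarrow> ty \<Rightarrow> tm" and star :: "ty \<Rightarrow> tm"
    and R X :: ty
  assumes eta_type: "has_type [] (eta Y) (Y \<rightarrow> T Y)"
    and ext_type: "has_type [] (ext Y Z) ((Y \<rightarrow> T Z) \<rightarrow> T Y \<rightarrow> T Z)"
    and star_type: "has_type [] (star Y) ((Y \<rightarrow> R) \<rightarrow> T Y \<rightarrow> R)"
begin

lemmas parameter_simps =
  eta_type[THEN infer_closed] ext_type[THEN infer_closed] star_type[THEN infer_closed]
  eta_type[THEN lift_closed] ext_type[THEN lift_closed] star_type[THEN lift_closed]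
  eta_type[THEN subst_closed] ext_type[THEN subst_closed] star_type[THEN subst_closed]

lemma tensor_type:
  "has_type [] (tensor T eta ext X) (T X \<rightarrow> (X \<rightarrow> T (Seq X)) \<rightarrow> T (Seq X))"
  by (simp add: tensor_def has_type_iff_infer parameter_simps)

lemmas simps = closed_simps parameter_simps
  tensor_type[THEN infer_closed] tensor_type[THEN lift_closed] tensor_type[THEN subst_closed]

abbreviation "R' \<equiv> (Seq X \<rightarrow> R) \<rightarrow> T (Seq X)"

section \<open>The term defining T-EPS, its type and its substitution instances\<close>

definition leaf :: tm where
  "leaf = Lam (Seq X) (Lam (Seq X \<rightarrow> R) (eta (Seq X) \<cdot> Cst (NilS X)))"

text \<open>\<open>node i\<close> is \<open>\<phi>\<close> with the selection functions \<open>\<epsilon>\<close> in variable \<open>i\<close>.\<close>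

definition node :: "nat \<Rightarrow> tm" where
  "node i = Lam (Seq X) (Lam (X \<rightarrow> R') (Lam (Seq X \<rightarrow> R)
     (tensor T eta ext X
       \<cdot> (Var (i + 3) \<cdot> Var 2 \<cdot> Lam X (star (Seq X) \<cdot> (shift X R \<cdot> Var 1 \<cdot> Var 0)
            \<cdot> (Var 2 \<cdot> Var 0 \<cdot> (shift X R \<cdot> Var 1 \<cdot> Var 0))))
       \<cdot> Lam X (Var 2 \<cdot> Var 0 \<cdot> (shift X R \<cdot> Var 1 \<cdot> Var 0)))))"

text \<open>There is no abstraction over \<open>q\<close>, since \<open>EPQ\<close> at
  \<open>R'\<close> already returns a function of \<open>q\<close>. Under the three binders,
  \<omega>, s and \<epsilon> are the indices 2, 1 and 0, hence \<open>node 0\<close>.\<close>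

definition EPS :: tm where
  "EPS = Lam ((Nat \<rightarrow> X) \<rightarrow> Nat) (Lam (Seq X) (Lam (Seq X \<rightarrow> (X \<rightarrow> R) \<rightarrow> T X)
     (Cst (EPQ X R') \<cdot> Var 2 \<cdot> Var 1 \<cdot> node 0 \<cdot> leaf)))"

lemma leaf_type: "has_type [] leaf (Seq X \<rightarrow> R')"
  by (simp add: leaf_def has_type_iff_infer simps)

lemma EPS_type: "has_type [] EPS (EPS_ty T X R)"
  by (simp add: EPS_def EPS_ty_def leaf_def node_def has_type_iff_infer simps)

lemma lift_node [simp]: "lift 0 (node i) = node (Suc i)"
  by (simp add: node_def simps)

text \<open>The only free index of \<open>node i\<close> is \<open>i\<close>, so lifting and
  substituting a variable act on it as on \<open>Var i\<close>.\<close>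

lemma subst_node [simp]:
  "i < k \<Longrightarrow> subst k v (node i) = node i"
  "k < i \<Longrightarrow> subst k v (node i) = node (i - 1)"
  "subst k (Var j) (node k) = node j"
  by (auto simp: node_def simps)

section \<open>Provable unfoldings of the defining term and of \<open>EPQ\<close>\<close>

lemmas leaf_simps = leaf_type[THEN infer_closed] leaf_type[THEN lift_closed]
  leaf_type[THEN subst_closed]

lemma node_type:
  "i < length \<Gamma> \<Longrightarrow> \<Gamma> ! i = Seq X \<rightarrow> (X \<rightarrow> R) \<rightarrow> T X
    \<Longrightarrow> has_type \<Gamma> (node i) (Seq X \<rightarrow> (X \<rightarrow> R') \<rightarrow> R')"
  by (simp add: node_def has_type_iff_infer simps)

text \<open>One beta step per abstraction. The stage \<open>s\<close> is an arbitrary term because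
  recursive calls occur at \<open>s*x\<close>; \<epsilon> remains a variable because
  \<open>node\<close> is indexed by one.\<close>

lemma EPS_eqv:
  assumes "a < length \<Gamma>" "\<Gamma> ! a = (Nat \<rightarrow> X) \<rightarrow> Nat"
    and "has_type \<Gamma> s (Seq X)"
    and "i < length \<Gamma>" "\<Gamma> ! i = Seq X \<rightarrow> (X \<rightarrow> R) \<rightarrow> T X"
  shows "eqv Ax \<Gamma> H R' (EPS \<cdot> Var a \<cdot> s \<cdot> Var i) (Cst (EPQ X R') \<cdot> Var a \<cdot> s \<cdot> node i \<cdot> leaf)"
proof -
  let ?E = "Seq X \<rightarrow> (X \<rightarrow> R) \<rightarrow> T X"
  have i: "has_type \<Gamma> (Var i) ?E" and a: "has_type \<Gamma> (Var a) ((Nat \<rightarrow> X) \<rightarrow> Nat)"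
    using assms by (auto simp: has_type_iff_infer)
  have s: "infer (lift 0 s) (?E # \<Gamma>) = Some (Seq X)"
    using has_type_lift assms(3) by (simp add: has_type_iff_infer)
  have n: "infer (node 0) (?E # \<Delta>) = Some (Seq X \<rightarrow> (X \<rightarrow> R') \<rightarrow> R')" for \<Delta>
    using node_type[of 0 "?E # \<Delta>"] by (simp add: has_type_iff_infer)
  \<comment> \<open>Two binders remain around the body, so \<open>Var a\<close> appears there as
    \<open>Var (a + 2)\<close>; each further beta step lowers it by one.\<close>
  have "eqv Ax \<Gamma> H (Seq X \<rightarrow> ?E \<rightarrow> R') (EPS \<cdot> Var a)
      (Lam (Seq X) (Lam ?E (Cst (EPQ X R') \<cdot> Var (a + 2) \<cdot> Var 1 \<cdot> node 0 \<cdot> leaf)))"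
    unfolding EPS_def
    by (rule eqv_beta[OF _ a]) (simp_all add: has_type_iff_infer n leaf_simps)
  note eqv_fun[OF this assms(3)]
  also have "eqv Ax \<Gamma> H (?E \<rightarrow> R')
      (Lam (Seq X) (Lam ?E (Cst (EPQ X R') \<cdot> Var (a + 2) \<cdot> Var 1 \<cdot> node 0 \<cdot> leaf)) \<cdot> s)
      (Lam ?E (Cst (EPQ X R') \<cdot> Var (a + 1) \<cdot> lift 0 s \<cdot> node 0 \<cdot> leaf))"
    using assms
    by (intro eqv_beta) (auto simp: has_type_iff_infer n leaf_simps node_def simps)
  finally have "eqv Ax \<Gamma> H (?E \<rightarrow> R') (EPS \<cdot> Var a \<cdot> s)
      (Lam ?E (Cst (EPQ X R') \<cdot> Var (a + 1) \<cdot> lift 0 s \<cdot> node 0 \<cdot> leaf))" .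
  note eqv_fun[OF this i]
  also have "eqv Ax \<Gamma> H R'
      (Lam ?E (Cst (EPQ X R') \<cdot> Var (a + 1) \<cdot> lift 0 s \<cdot> node 0 \<cdot> leaf) \<cdot> Var i)
      (Cst (EPQ X R') \<cdot> Var a \<cdot> s \<cdot> node i \<cdot> leaf)"
    using assms by (intro eqv_beta[OF _ i]) (auto simp: has_type_iff_infer n s leaf_simps)
  finally show ?thesis .
qed

text \<open>\<open>leaf\<close> is constant in its sequence argument, so prepending \<open>x\<close>
  to that argument changes nothing.\<close>

lemma shift_leaf_eqv:
  assumes "has_type \<Gamma> x X"
  shows "eqv Ax \<Gamma> H (Seq X \<rightarrow> R') (shift X R' \<cdot> leaf \<cdot> x) leaf"
proof -
  let ?r = "Lam (Seq X) (leaf \<cdot> (Cst (ConsS X) \<cdot> lift 0 x \<cdot> Var 0))"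
  have x: "has_type (Seq X # \<Gamma>) (lift 0 x) X"
    by (rule has_type_lift) fact
  have "eqv Ax \<Gamma> H (X \<rightarrow> Seq X \<rightarrow> R') (shift X R' \<cdot> leaf)
      (Lam X (Lam (Seq X) (leaf \<cdot> (Cst (ConsS X) \<cdot> Var 1 \<cdot> Var 0))))"
    unfolding shift_def
    by (intro eqv_beta) (auto simp: has_type_iff_infer leaf_simps)
  note eqv_fun[OF this assms]
  also have "eqv Ax \<Gamma> H (Seq X \<rightarrow> R')
      (Lam X (Lam (Seq X) (leaf \<cdot> (Cst (ConsS X) \<cdot> Var 1 \<cdot> Var 0))) \<cdot> x) ?r"
    using assms by (intro eqv_beta) (auto simp: has_type_iff_infer leaf_simps)
  \<comment> \<open>With \<open>leaf\<close> unfolded on both sides, the bodies differ by one beta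
    step that discards \<open>x*r\<close>.\<close>
  also have "eqv Ax \<Gamma> H (Seq X \<rightarrow> R') ?r leaf"
    unfolding leaf_def using x
    by (intro eqv_Lam eqv_beta) (auto simp: has_type_iff_infer simps)
  finally show ?thesis .
qed

text \<open>The axiom for \<open>EPQ\<close> is instantiated outermost quantifier first: \<omega>,
  s, then \<open>node i\<close> for \<phi> and \<open>leaf\<close> for the outcome function. Under
  the binder of \<open>x\<close>, \<open>node i\<close> becomes \<open>node (Suc i)\<close>.\<close>

lemma prov_EPQ_unfold:
  assumes "a < length \<Gamma>" "\<Gamma> ! a = (Nat \<rightarrow> X) \<rightarrow> Nat"
    and "b < length \<Gamma>" "\<Gamma> ! b = Seq X"
    and "i < length \<Gamma>" "\<Gamma> ! i = Seq X \<rightarrow> (X \<rightarrow> R) \<rightarrow> T X"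
  shows "prov EPQ_axioms \<Gamma> H
    (And
      (Imp (Stop X (Var a) (Var b))
        (Eq R' (Cst (EPQ X R') \<cdot> Var a \<cdot> Var b \<cdot> node i \<cdot> leaf) (leaf \<cdot> Cst (NilS X))))
      (Imp (Continue X (Var a) (Var b))
        (Eq R' (Cst (EPQ X R') \<cdot> Var a \<cdot> Var b \<cdot> node i \<cdot> leaf)
          (node i \<cdot> Var b \<cdot> Lam X (Cst (EPQ X R') \<cdot> Var (Suc a) \<cdot> (snoc X \<cdot> Var (Suc b) \<cdot> Var 0)
             \<cdot> node (Suc i) \<cdot> (shift X R' \<cdot> leaf \<cdot> Var 0))))))"
proof -
  have a: "has_type \<Gamma> (Var a) ((Nat \<rightarrow> X) \<rightarrow> Nat)" and b: "has_type \<Gamma> (Var b) (Seq X)"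
    and leaf: "has_type \<Gamma> leaf (Seq X \<rightarrow> R')"
    using assms by (auto simp: has_type_iff_infer leaf_simps)
  note p = prov_EPQ_spec[of \<Gamma> H X R', unfolded EPQ_spec_def]
  note p1 = AllE[OF p a, simplified substf.simps]
  note p2 = AllE[OF p1 b, simplified substf.simps]
  note p3 = AllE[OF p2 node_type[OF assms(5,6)], simplified substf.simps]
  note p4 = AllE[OF p3 leaf]
  then show ?thesis
    by (simp add: closed_simps leaf_simps)
qed

text \<open>Three beta steps, consuming s, the recursive results \<open>P\<close> and the outcome
  function; \<open>?B1\<close> and \<open>?B2\<close> are the bodies left after the first and the
  second.\<close>

lemma node_eqv:
  assumes i: "i < length \<Gamma>" "\<Gamma> ! i = Seq X \<rightarrow> (X \<rightarrow> R) \<rightarrow> T X"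
    and b: "b < length \<Gamma>" "\<Gamma> ! b = Seq X"
    and P: "has_type \<Gamma> P (X \<rightarrow> R')"
    and c: "c < length \<Gamma>" "\<Gamma> ! c = Seq X \<rightarrow> R"
  shows "eqv Ax \<Gamma> H (T (Seq X)) (node i \<cdot> Var b \<cdot> P \<cdot> Var c)
    (tensor T eta ext X
      \<cdot> (Var i \<cdot> Var b \<cdot> Lam X (star (Seq X) \<cdot> (shift X R \<cdot> Var (Suc c) \<cdot> Var 0)
           \<cdot> (lift 0 P \<cdot> Var 0 \<cdot> (shift X R \<cdot> Var (Suc c) \<cdot> Var 0))))
      \<cdot> Lam X (lift 0 P \<cdot> Var 0 \<cdot> (shift X R \<cdot> Var (Suc c) \<cdot> Var 0)))"
    (is "eqv _ _ _ _ _ ?rhs")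
proof -
  let ?B1 = "Lam (Seq X \<rightarrow> R) (tensor T eta ext X
       \<cdot> (Var (i + 2) \<cdot> Var (b + 2) \<cdot> Lam X (star (Seq X) \<cdot> (shift X R \<cdot> Var 1 \<cdot> Var 0)
            \<cdot> (Var 2 \<cdot> Var 0 \<cdot> (shift X R \<cdot> Var 1 \<cdot> Var 0))))
       \<cdot> Lam X (Var 2 \<cdot> Var 0 \<cdot> (shift X R \<cdot> Var 1 \<cdot> Var 0)))"
  let ?B2 = "Lam (Seq X \<rightarrow> R) (tensor T eta ext X
       \<cdot> (Var (i + 1) \<cdot> Var (b + 1) \<cdot> Lam X (star (Seq X) \<cdot> (shift X R \<cdot> Var 1 \<cdot> Var 0)
            \<cdot> (lift 0 (lift 0 P) \<cdot> Var 0 \<cdot> (shift X R \<cdot> Var 1 \<cdot> Var 0))))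
       \<cdot> Lam X (lift 0 (lift 0 P) \<cdot> Var 0 \<cdot> (shift X R \<cdot> Var 1 \<cdot> Var 0)))"
  have PP: "infer (lift 0 (lift 0 P)) (Y # Z # \<Gamma>) = Some (X \<rightarrow> R')" for Y Z
    using has_type_lift[OF has_type_lift[OF P]] by (simp add: has_type_iff_infer)
  have vars: "has_type \<Gamma> (Var b) (Seq X)" "has_type \<Gamma> (Var c) (Seq X \<rightarrow> R)"
    using b c by (simp_all add: has_type_iff_infer)
  have "eqv Ax \<Gamma> H ((X \<rightarrow> R') \<rightarrow> R') (node i \<cdot> Var b) (Lam (X \<rightarrow> R') ?B1)"
    unfolding node_def using i b
    by (intro eqv_beta) (auto simp: has_type_iff_infer simps)
  note eqv_fun[OF this P]
  also have "eqv Ax \<Gamma> H R' (Lam (X \<rightarrow> R') ?B1 \<cdot> P) ?B2"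
    using i b P by (intro eqv_beta) (auto simp: has_type_iff_infer simps)
  finally have "eqv Ax \<Gamma> H R' (node i \<cdot> Var b \<cdot> P) ?B2" .
  note eqv_fun[OF this vars(2)]
  also have "eqv Ax \<Gamma> H (T (Seq X)) (?B2 \<cdot> Var c) ?rhs"
    using i b c PP by (intro eqv_beta) (auto simp: has_type_iff_infer simps)
  finally show ?thesis .
qed

text \<open>Both clauses follow one route: rewrite \<open>EPS\<close> to \<open>EPQ\<close> at the
  function type \<open>R'\<close>, unfold \<open>EPQ\<close> once, and only then apply the equation
  to \<open>q\<close>.\<close>

lemma prov_EPS_spec: "provable EPQ_axioms (EPS_spec T eta ext star X R EPS)"
proof -
  \<comment> \<open>Innermost binder first: \<open>q\<close>, \<epsilon>, s, \<omega> at the indices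
    0 to 3.\<close>
  let ?\<Gamma> = "[Seq X \<rightarrow> R, Seq X \<rightarrow> (X \<rightarrow> R) \<rightarrow> T X, Seq X, (Nat \<rightarrow> X) \<rightarrow> Nat]"
  let ?S = "Stop X (Var 3) (Var 2)"
  let ?C = "Continue X (Var 3) (Var 2)"
  let ?EPS = "EPS \<cdot> Var 3 \<cdot> Var 2 \<cdot> Var 1"
  let ?EPQ = "Cst (EPQ X R') \<cdot> Var 3 \<cdot> Var 2 \<cdot> node 1 \<cdot> leaf"
  let ?rec = "EPS \<cdot> Var 4 \<cdot> (snoc X \<cdot> Var 3 \<cdot> Var 0) \<cdot> Var 2"
  \<comment> \<open>\<open>?Psh\<close> is the family of recursive results as the \<open>EPQ\<close>
    equation produces it, with a shifted \<open>leaf\<close>; \<open>?P\<close> is the same family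
    written with \<open>EPS\<close>.\<close>
  let ?Psh = "Lam X (Cst (EPQ X R') \<cdot> Var 4 \<cdot> (snoc X \<cdot> Var 3 \<cdot> Var 0) \<cdot> node 2
     \<cdot> (shift X R' \<cdot> leaf \<cdot> Var 0))"
  let ?P = "Lam X ?rec"
  let ?q = "shift X R \<cdot> Var 1 \<cdot> Var 0"
  let ?f = "Lam X (?rec \<cdot> ?q)"
  let ?a = "Var 1 \<cdot> Var 2 \<cdot> Lam X (star (Seq X) \<cdot> ?q \<cdot> (lift 0 ?f \<cdot> Var 0))"
  note EPS_simps = EPS_type[unfolded EPS_ty_def, THEN infer_closed]
    EPS_type[THEN lift_closed] EPS_type[THEN subst_closed]
  note all_simps = has_type_iff_infer simps EPS_simps leaf_simps
  have wff: "wff ?\<Gamma> ?S" "wff ?\<Gamma> ?C"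
    by (auto intro!: wff_Stop wff_Continue simp: has_type_iff_infer)
  have EPQ: "prov EPQ_axioms ?\<Gamma> H (And
      (Imp ?S (Eq R' ?EPQ (leaf \<cdot> Cst (NilS X))))
      (Imp ?C (Eq R' ?EPQ (node 1 \<cdot> Var 2 \<cdot> ?Psh))))" for H
    using prov_EPQ_unfold[of 3 ?\<Gamma> 2 1 H] by (simp add: numeral_eq_Suc)
  have EPQ_type: "has_type ?\<Gamma> ?EPQ R'"
    using node_type[of 1 ?\<Gamma>] by (simp add: all_simps)
  have P_type: "has_type ?\<Gamma> ?P (X \<rightarrow> R')"
    by (simp add: all_simps)
  have node_type1: "has_type ?\<Gamma> (node 1 \<cdot> Var 2) ((X \<rightarrow> R') \<rightarrow> R')"
    using node_type[of 1 ?\<Gamma>] by (simp add: all_simps)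
  have EPS_EPQ: "eqv EPQ_axioms ?\<Gamma> H R' ?EPS ?EPQ" for H
    by (rule EPS_eqv) (simp_all add: all_simps)
  have q_type: "has_type ?\<Gamma> (Var 0) (Seq X \<rightarrow> R)"
    by (simp add: has_type_iff_infer)

  \<comment> \<open>Stopping case: \<open>EPQ\<close> returns \<open>leaf\<close> at the empty
    sequence, which is the constant function with value \<eta> of the empty sequence.\<close>
  have "prov EPQ_axioms ?\<Gamma> {?S} (Eq R' ?EPQ (leaf \<cdot> Cst (NilS X)))"
    using ImpE[OF AndE1[OF EPQ]] hyp[of ?S "{?S}"] wff by blast
  then have "eqv EPQ_axioms ?\<Gamma> {?S} R' ?EPQ (leaf \<cdot> Cst (NilS X))"
    using EPQ_type by (simp add: eqv_def) (simp add: all_simps)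
  also have "eqv EPQ_axioms ?\<Gamma> {?S} R' (leaf \<cdot> Cst (NilS X))
      (Lam (Seq X \<rightarrow> R) (eta (Seq X) \<cdot> Cst (NilS X)))"
    unfolding leaf_def by (rule eqv_beta) (simp_all add: all_simps)
  finally have "eqv EPQ_axioms ?\<Gamma> {?S} R' ?EPS
      (Lam (Seq X \<rightarrow> R) (eta (Seq X) \<cdot> Cst (NilS X)))"
    by (rule eqv_trans[OF EPS_EPQ])
  note eqv_fun[OF this q_type]
  also have "eqv EPQ_axioms ?\<Gamma> {?S} (T (Seq X))
      (Lam (Seq X \<rightarrow> R) (eta (Seq X) \<cdot> Cst (NilS X)) \<cdot> Var 0) (eta (Seq X) \<cdot> Cst (NilS X))"
    by (rule eqv_beta) (simp_all add: all_simps)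
  finally have stop: "prov EPQ_axioms ?\<Gamma> {?S}
      (Eq (T (Seq X)) (?EPS \<cdot> Var 0) (eta (Seq X) \<cdot> Cst (NilS X)))"
    by (simp add: eqv_def)

  \<comment> \<open>Under the binder of \<open>x\<close>, \<open>shift_leaf_eqv\<close> removes the
    shift, and \<open>EPS_eqv\<close> read backwards at stage \<open>s*x\<close> restores
    \<open>EPS\<close>.\<close>
  have P: "eqv EPQ_axioms ?\<Gamma> H (X \<rightarrow> R') ?Psh ?P" for H
  proof (rule eqv_Lam)
    let ?G = "Cst (EPQ X R') \<cdot> Var 4 \<cdot> (snoc X \<cdot> Var 3 \<cdot> Var 0) \<cdot> node 2"
    have "eqv EPQ_axioms (X # ?\<Gamma>) (liftf 0 ` H) R' (?G \<cdot> (shift X R' \<cdot> leaf \<cdot> Var 0)) (?G \<cdot> leaf)"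
      using node_type[of 2 "X # ?\<Gamma>"]
      by (intro eqv_arg[OF shift_leaf_eqv]) (simp_all add: all_simps)
    also have "eqv EPQ_axioms (X # ?\<Gamma>) (liftf 0 ` H) R' (?G \<cdot> leaf) ?rec"
      by (rule eqv_sym[OF EPS_eqv]) (simp_all add: all_simps)
    finally show "eqv EPQ_axioms (X # ?\<Gamma>) (liftf 0 ` H) R' (?G \<cdot> (shift X R' \<cdot> leaf \<cdot> Var 0)) ?rec" .
  qed
  have beta: "eqv EPQ_axioms (X # ?\<Gamma>) H (T (Seq X)) (lift 0 ?P \<cdot> Var 0 \<cdot> ?q) (?rec \<cdot> ?q)" for H
    by (intro eqv_fun[where X = "Seq X \<rightarrow> R"]) (auto intro!: eqv_beta simp: all_simps)
  have f: "eqv EPQ_axioms ?\<Gamma> H (X \<rightarrow> T (Seq X)) (Lam X (lift 0 ?P \<cdot> Var 0 \<cdot> ?q)) ?f" for H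
    by (rule eqv_Lam[OF beta])
  \<comment> \<open>The specification writes \<open>f x\<close> as a redex, whereas
    \<open>node_eqv\<close> yields the redex \<open>?P x\<close> applied to the shifted
    \<open>q\<close>. Both reduce to \<open>?rec \<cdot> ?q\<close>, so the two arguments of
    \<epsilon> agree.\<close>
  have beta_f: "eqv EPQ_axioms (X # ?\<Gamma>) H (T (Seq X)) (lift 0 ?f \<cdot> Var 0) (?rec \<cdot> ?q)" for H
    by (auto intro!: eqv_beta simp: all_simps)
  have a: "eqv EPQ_axioms ?\<Gamma> H (T X)
      (Var 1 \<cdot> Var 2 \<cdot> Lam X (star (Seq X) \<cdot> ?q \<cdot> (lift 0 ?P \<cdot> Var 0 \<cdot> ?q))) ?a" for H
    by (rule eqv_arg[OF eqv_Lam[OF eqv_arg[OF eqv_trans[OF beta eqv_sym[OF beta_f]]]]])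
      (simp_all add: all_simps)
  have "prov EPQ_axioms ?\<Gamma> {?C} (Eq R' ?EPQ (node 1 \<cdot> Var 2 \<cdot> ?Psh))"
    using ImpE[OF AndE2[OF EPQ]] hyp[of ?C "{?C}"] wff by blast
  \<comment> \<open>Besides the equation, \<open>NP\<close> provides the typing of the right-hand
    side needed to form the \<open>eqv\<close>.\<close>
  moreover note NP = eqv_arg[OF P node_type1]
  ultimately have "eqv EPQ_axioms ?\<Gamma> {?C} R' ?EPQ (node 1 \<cdot> Var 2 \<cdot> ?Psh)"
    using EPQ_type by (simp add: eqv_def)
  also note NP
  finally have "eqv EPQ_axioms ?\<Gamma> {?C} R' ?EPS (node 1 \<cdot> Var 2 \<cdot> ?P)"
    by (rule eqv_trans[OF EPS_EPQ])
  note eqv_fun[OF this q_type]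
  also have "eqv EPQ_axioms ?\<Gamma> {?C} (T (Seq X)) (node 1 \<cdot> Var 2 \<cdot> ?P \<cdot> Var 0)
    (tensor T eta ext X
      \<cdot> (Var 1 \<cdot> Var 2 \<cdot> Lam X (star (Seq X) \<cdot> ?q \<cdot> (lift 0 ?P \<cdot> Var 0 \<cdot> ?q)))
      \<cdot> Lam X (lift 0 ?P \<cdot> Var 0 \<cdot> ?q))"
    using node_eqv[of 1 ?\<Gamma> 2 ?P 0] P_type by simp
  also have "eqv EPQ_axioms ?\<Gamma> {?C} (T (Seq X)) \<dots> (tensor T eta ext X \<cdot> ?a \<cdot> ?f)"
    by (intro eqv_App[OF _ f] eqv_arg[OF a]) (simp add: all_simps)
  finally have continue: "prov EPQ_axioms ?\<Gamma> {?C}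
      (Eq (T (Seq X)) (?EPS \<cdot> Var 0) (tensor T eta ext X \<cdot> ?a \<cdot> ?f))"
    by (simp add: eqv_def)

  show ?thesis
    unfolding EPS_spec_def Let_def
    using stop continue wff by (auto intro!: AllI AndI ImpI)
qed

end

theorem theorem3p4:
  fixes T :: "ty \<Rightarrow> ty"
    and eta :: "ty \<Rightarrow> tm" and ext :: "ty \<Rightarrow> ty \<Rightarrow> tm" and star :: "ty \<Rightarrow> tm"
    and R X :: ty
  assumes "strong_monad T eta ext"
    and "monad_algebra T eta ext R star"
  shows "EPS_definable_from_EPQ T eta ext star X R"
proof -
  \<comment> \<open>The assumptions provide the closed typings of \<open>eta\<close>,
    \<open>ext\<close> and \<open>star\<close>; the witness is then \<open>EPS\<close>.\<close>
  interpret typed_algebra T eta ext star R X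
    using assms by unfold_locales (auto simp: strong_monad_def monad_algebra_def)
  show ?thesis
    using EPS_type prov_EPS_spec by (auto simp: EPS_definable_from_EPQ_def)
qed

end
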